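(* Let $X=[\ell,u]\subseteq\mathbb{R}^n$ be a box with $\ell_i<u_i$ for all $i$, let $g:\mathbb{R}^n\to\mathbb{R}$ be a convex function and $\epsilon>0$. When Algorithm 1 (defined in the context) stops, it returns an $\epsilon$-polyhedral underestimator of $g$ on $X$; that is, the returned function $g^k$ is polyhedral convex and satisfies $0\le g(x)-g^k(x)\le\epsilon$ for all $x\in X$.
   Context: $X=\{x\in\mathbb{R}^n\mid \ell_i\le x_i\le u_i,\ i=1,\dots,n\}$ with $\ell_i<u_i$ for all $i$. A function is polyhedral convex if its epigraph is a polyhedral convex set. A polyhedral convex $\bar g:\mathbb{R}^n\to\mathbb{R}$ is an $\epsilon$-polyhedral underestimator of $g$ on $X$ if $0\le g(x)-\bar g(x)\le\epsilon$ for all $x\in X$. For $x\in\mathbb{R}^n$, $c(x)$ denotes an (arbitrary, chosen) element of the subdifferential $\partial g(x)$, and for $x^*\in\mathbb{R}^n$, $$H(g,x^* )=\{(x,t)\in\mathbb{R}^n\times\mathbb{R}\mid t-c(x^* )^{\mathsf T}x\ge g(x^* )-c(x^* )^{\mathsf T}x^*\}.$$ $\operatorname{vert} C$ denotes the set of vertices of a polyhedral convex set $C$. Algorithm 1 (input $g$, $X=[\ell,u]$, $\epsilon$): Set $k=0$, $x^0=\frac{\ell+u}{2}$, $C^0=H(g,x^0)\cap(X\times\mathbb{R})$, $g^0(x)=g(x^0)+c(x^0)^{\mathsf T}(x-x^0)$. Repeat: compute $\operatorname{vert}C^k$ and choose $(\bar x,\bar y)\in\arg\max_{(x,y)\in\operatorname{vert}C^k}(g(x)-y)$.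 If $g(\bar x)-\bar y>\epsilon$, set $C^{k+1}=C^k\cap H(g,\bar x)$, $g^{k+1}(x)=\max\{g^k(x),\,g(\bar x)+c(\bar x)^{\mathsf T}(x-\bar x)\}$, and increase $k$ by $1$; otherwise stop and return $g^k$ (and $\operatorname{vert}C^k$). *)

theory Defs
  imports "HOL-Analysis.Analysis"
begin

definition subdifferential :: "(real^'n \<Rightarrow> real) \<Rightarrow> real^'n \<Rightarrow> (real^'n) set" where
  "subdifferential g x = {s. \<forall>y. g y \<ge> g x + s \<bullet> (y - x)}"

(* The map c is a selection of subgradients of g. *)
definition H_set :: "(real^'n \<Rightarrow> real) \<Rightarrow> (real^'n \<Rightarrow> real^'n) \<Rightarrow> real^'n \<Rightarrow> ((real^'n) \<times> real) set" where
  "H_set g c z = {(x, t). t - c z \<bullet> x \<ge> g z - c z \<bullet> z}"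

definition polyhedral_convex_fun :: "(real^'n \<Rightarrow> real) \<Rightarrow> bool" where
  "polyhedral_convex_fun h \<longleftrightarrow> polyhedron (epigraph UNIV h)"

definition eps_polyhedral_underestimator ::
    "real \<Rightarrow> (real^'n \<Rightarrow> real) \<Rightarrow> (real^'n) set \<Rightarrow> (real^'n \<Rightarrow> real) \<Rightarrow> bool" where
  "eps_polyhedral_underestimator \<epsilon> g X h \<longleftrightarrow>
     polyhedral_convex_fun h \<and> (\<forall>x\<in>X. 0 \<le> g x - h x \<and> g x - h x \<le> \<epsilon>)"

(* The vertices of a polyhedral convex set are its extreme points. *)
definition vert :: "((real^'n) \<times> real) set \<Rightarrow> ((real^'n) \<times> real) set" where
  "vert C = {v. v extreme_point_of C}"

definition argmax_vert :: "(real^'n \<Rightarrow> real) \<Rightarrow> ((real^'n) \<times> real) set \<Rightarrow> ((real^'n) \<times> real) set" where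
  "argmax_vert g C = {p. is_arg_max (\<lambda>(x, y). g x - y) (\<lambda>q. q \<in> vert C) p}"

(* algorithm1_state g c l u \<epsilon> k C h: some run of the algorithm, with subgradient selection c,
   reaches iteration k with C = C^k and h = g^k.  The choice of the maximizing vertex is
   nondeterministic, so the predicate covers all runs. *)
inductive algorithm1_state ::
    "(real^'n \<Rightarrow> real) \<Rightarrow> (real^'n \<Rightarrow> real^'n) \<Rightarrow> real^'n \<Rightarrow> real^'n \<Rightarrow> real \<Rightarrow>
     nat \<Rightarrow> ((real^'n) \<times> real) set \<Rightarrow> (real^'n \<Rightarrow> real) \<Rightarrow> bool"
  for g c l u \<epsilon> where
  init: "x0 = (1/2) *\<^sub>R (l + u) \<Longrightarrow>
    algorithm1_state g c l u \<epsilon> 0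
      (H_set g c x0 \<inter> (cbox l u \<times> UNIV))
      (\<lambda>x. g x0 + c x0 \<bullet> (x - x0))"
| step: "algorithm1_state g c l u \<epsilon> k C h \<Longrightarrow>
    (xb, yb) \<in> argmax_vert g C \<Longrightarrow> g xb - yb > \<epsilon> \<Longrightarrow>
    algorithm1_state g c l u \<epsilon> (Suc k)
      (C \<inter> H_set g c xb)
      (\<lambda>x. max (h x) (g xb + c xb \<bullet> (x - xb)))"

definition algorithm1_returns ::
    "(real^'n \<Rightarrow> real) \<Rightarrow> (real^'n \<Rightarrow> real^'n) \<Rightarrow> real^'n \<Rightarrow> real^'n \<Rightarrow> real \<Rightarrow>
     (real^'n \<Rightarrow> real) \<Rightarrow> ((real^'n) \<times> real) set \<Rightarrow> bool" where
  "algorithm1_returns g c l u \<epsilon> h V \<longleftrightarrow>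
     (\<exists>k C xb yb. algorithm1_state g c l u \<epsilon> k C h \<and>
        (xb, yb) \<in> argmax_vert g C \<and> \<not> g xb - yb > \<epsilon> \<and> V = vert C)"

end

theory Submission
  imports Defs
begin

text \<open>
  The iterate \<open>C\<close> is the part over the box of the epigraph of the current model \<open>h\<close>, and \<open>h\<close> is a
  maximum of finitely many affine minorants of \<open>g\<close>.  So \<open>h\<close> is polyhedral convex and lies below \<open>g\<close>,
  and only the upper bound on the gap \<open>g - h\<close> needs an argument.

  The stopping test bounds \<open>g x - y\<close> by \<open>\<epsilon>\<close> at the vertices \<open>(x, y)\<close> of \<open>C\<close>.  The points satisfying
  this bound form the epigraph of the convex function \<open>g - \<epsilon>\<close>, hence a convex set, and it remains to
  see that every point \<open>(x, h x)\<close> of the lower boundary of \<open>C\<close> is a convex combination of vertices.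
  As \<open>C\<close> contains vertical rays it is not the convex hull of its vertices.  But a subgradient of
  \<open>h\<close> at \<open>x\<close> defines a non-vertical hyperplane supporting \<open>C\<close> at \<open>(x, h x)\<close>.  It cuts out a face of
  \<open>C\<close> that lies in the graph of an affine function over the box, so this face is compact, and the
  Krein--Milman theorem writes it as the convex hull of its own extreme points, which are vertices
  of \<open>C\<close>.
\<close>

section \<open>The lower boundary of an epigraph over a compact set\<close>

text \<open>
  The supporting hyperplane given by a subgradient is not vertical, so the face that it exposes lies
  in a compact piece of a graph and, unlike the epigraph itself, is the hull of its extreme points.
\<close>

lemma lower_boundary_in_hull_vert:
  fixes h :: "real^'n \<Rightarrow> real"
  assumes "compact K" and closed: "closed (epigraph K h)" and convex: "convex (epigraph K h)"
    and s: "s \<in> subdifferential h x" and "x \<in> K"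
  shows "(x, h x) \<in> convex hull (vert (epigraph K h))"
proof -
  let ?C = "epigraph K h"
  define F where "F = ?C \<inter> {q. (- s, 1) \<bullet> q = h x - s \<bullet> x}"
  have "(- s, 1) \<bullet> q \<ge> h x - s \<bullet> x" if "q \<in> ?C" for q
  proof -
    have "h x + s \<bullet> (fst q - x) \<le> h (fst q)"
      using s by (simp add: subdifferential_def)
    moreover have "h (fst q) \<le> snd q"
      using that by (simp add: epigraph_def)
    ultimately show ?thesis
      by (cases q) (simp add: inner_diff_right)
  qed
  then have face: "F face_of ?C"
    unfolding F_def using convex by (intro face_of_Int_supporting_hyperplane_ge)
  have "F \<subseteq> (\<lambda>y. (y, h x + s \<bullet> (y - x))) ` K"
    by (auto simp: F_def epigraph_def image_iff inner_diff_right)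
  moreover have "compact ((\<lambda>y. (y, h x + s \<bullet> (y - x))) ` K)"
    by (intro compact_continuous_image continuous_intros \<open>compact K\<close>)
  moreover have "closed F"
    unfolding F_def by (intro closed_Int closed closed_hyperplane)
  ultimately have "compact F"
    by (metis compact_Int_closed inf.absorb_iff2)
  then have "F = convex hull {v. v extreme_point_of F}"
    using face face_of_imp_convex by (intro Krein_Milman_Minkowski) auto
  moreover have "{v. v extreme_point_of F} \<subseteq> vert ?C"
    using extreme_point_of_face[OF face] by (auto simp: vert_def)
  moreover have "(x, h x) \<in> F"
    using \<open>x \<in> K\<close> by (simp add: F_def epigraph_def)
  ultimately show ?thesis
    by (metis hull_mono subsetD)
qed

text \<open>
  Since \<open>g - \<epsilon>\<close> is convex, its epigraph contains the hull of the vertices as soon as it contains the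
  vertices.
\<close>

lemma gap_le_if_gap_le_on_vert:
  fixes g h :: "real^'n \<Rightarrow> real"
  assumes "convex_on UNIV g"
    and "compact K" "closed (epigraph K h)" "convex (epigraph K h)"
    and "subdifferential h x \<noteq> {}" and "x \<in> K"
    and gap: "\<And>v t. (v, t) \<in> vert (epigraph K h) \<Longrightarrow> g v - t \<le> \<epsilon>"
  shows "g x - h x \<le> \<epsilon>"
proof -
  have "convex_on UNIV (\<lambda>v. g v + (- \<epsilon>))"
    by (intro convex_on_add assms) (simp add: convex_on_const)
  then have "convex (epigraph UNIV (\<lambda>v. g v - \<epsilon>))"
    by (simp add: convex_epigraph)
  moreover have "vert (epigraph K h) \<subseteq> epigraph UNIV (\<lambda>v. g v - \<epsilon>)"
    using gap by (force simp: epigraph_def)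
  ultimately have "convex hull (vert (epigraph K h)) \<subseteq> epigraph UNIV (\<lambda>v. g v - \<epsilon>)"
    by (rule hull_minimal[rotated])
  then have "(x, h x) \<in> epigraph UNIV (\<lambda>v. g v - \<epsilon>)"
    using lower_boundary_in_hull_vert assms by blast
  then show ?thesis
    by (simp add: epigraph_def)
qed

section \<open>Invariants of the cutting plane iteration\<close>

lemma H_set_eq_epigraph: "H_set g c z = epigraph UNIV (\<lambda>x. g z + c z \<bullet> (x - z))"
  by (auto simp: H_set_def epigraph_def inner_diff_right)

lemma polyhedral_convex_fun_affine:
  fixes s z :: "real^'n"
  shows "polyhedral_convex_fun (\<lambda>x. b + s \<bullet> (x - z))"
proof -
  have "epigraph UNIV (\<lambda>x. b + s \<bullet> (x - z)) = {q. (- s, 1) \<bullet> q \<ge> b - s \<bullet> z}"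
    by (auto simp: epigraph_def inner_diff_right)
  then show ?thesis
    by (simp add: polyhedral_convex_fun_def polyhedron_halfspace_ge)
qed

lemma epigraph_max:
  "epigraph S (\<lambda>x. max (f x) (h x)) = epigraph S f \<inter> epigraph S h"
  by (auto simp: epigraph_def)

lemma polyhedral_convex_fun_max:
  assumes "polyhedral_convex_fun f" "polyhedral_convex_fun h"
  shows "polyhedral_convex_fun (\<lambda>x. max (f x) (h x))"
  using assms by (simp add: polyhedral_convex_fun_def epigraph_max)

lemma subdifferential_affine:
  "s \<in> subdifferential (\<lambda>x. b + s \<bullet> (x - z)) x"
  by (simp add: subdifferential_def inner_diff_right)

text \<open>A subgradient of a function that attains the maximum at \<open>x\<close> is one of the maximum.\<close>

lemma subdifferential_max_nonempty:
  assumes "subdifferential f x \<noteq> {}" "subdifferential h x \<noteq> {}"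
  shows "subdifferential (\<lambda>x. max (f x) (h x)) x \<noteq> {}"
proof (cases "h x \<le> f x")
  case True
  obtain s where "s \<in> subdifferential f x" using assms by blast
  then have "s \<in> subdifferential (\<lambda>x. max (f x) (h x)) x"
    using True by (simp add: subdifferential_def le_max_iff_disj max_absorb1)
  then show ?thesis by blast
next
  case False
  obtain s where "s \<in> subdifferential h x" using assms by blast
  then have "s \<in> subdifferential (\<lambda>x. max (f x) (h x)) x"
    using False by (simp add: subdifferential_def le_max_iff_disj max_absorb2)
  then show ?thesis by blast
qed

lemma algorithm1_state_epigraph:
  assumes "algorithm1_state g c l u \<epsilon> k C h"
  shows "C = epigraph (cbox l u) h"
  using assms
proof induction
  case (init x0)
  show ?case by (auto simp: H_set_eq_epigraph epigraph_def)
next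
  case (step k C h xb yb)
  then show ?case by (auto simp: H_set_eq_epigraph epigraph_def)
qed

lemma algorithm1_state_polyhedral:
  assumes "algorithm1_state g c l u \<epsilon> k C h"
  shows "polyhedral_convex_fun h"
  using assms
  by induction (auto intro: polyhedral_convex_fun_affine polyhedral_convex_fun_max)

lemma algorithm1_state_subdifferential_nonempty:
  assumes "algorithm1_state g c l u \<epsilon> k C h"
  shows "subdifferential h x \<noteq> {}"
  using assms
proof induction
  case (init x0)
  show ?case using subdifferential_affine by blast
next
  case (step k C h xb yb)
  have "subdifferential (\<lambda>x. g xb + c xb \<bullet> (x - xb)) x \<noteq> {}"
    using subdifferential_affine by blast
  with step.IH show ?case by (rule subdifferential_max_nonempty)
qed

lemma algorithm1_state_le:
  assumes "algorithm1_state g c l u \<epsilon> k C h" and "\<forall>x. c x \<in> subdifferential g x"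
  shows "h x \<le> g x"
  using assms by induction (simp_all add: subdifferential_def)

section \<open>Correctness of the returned model\<close>

theorem theorem3p3:
  fixes l u :: "real^'n" and g :: "real^'n \<Rightarrow> real" and c :: "real^'n \<Rightarrow> real^'n"
    and \<epsilon> :: real and h :: "real^'n \<Rightarrow> real" and V :: "((real^'n) \<times> real) set"
  assumes "\<forall>i. l $ i < u $ i"
    and "convex_on UNIV g"
    and "\<epsilon> > 0"
    and "\<forall>x. c x \<in> subdifferential g x"
    and "algorithm1_returns g c l u \<epsilon> h V"
  shows "eps_polyhedral_underestimator \<epsilon> g (cbox l u) h"
proof -
  obtain k C xb yb where state: "algorithm1_state g c l u \<epsilon> k C h"
    and amax: "(xb, yb) \<in> argmax_vert g C" and stop: "\<not> g xb - yb > \<epsilon>"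
    using assms(5) by (auto simp: algorithm1_returns_def)
  have C: "C = epigraph (cbox l u) h"
    using state by (rule algorithm1_state_epigraph)
  have poly: "polyhedral_convex_fun h"
    using state by (rule algorithm1_state_polyhedral)
  have gap: "g v - t \<le> \<epsilon>" if "(v, t) \<in> vert (epigraph (cbox l u) h)" for v t
    using amax stop that by (force simp: argmax_vert_def is_arg_max_def C)
  have cut: "epigraph (cbox l u) h = epigraph UNIV h \<inter> (cbox l u \<times> UNIV)"
    by (auto simp: epigraph_def)
  have "closed (epigraph (cbox l u) h)"
    unfolding cut using poly
    by (intro closed_Int closed_Times polyhedron_imp_closed) (auto simp: polyhedral_convex_fun_def)
  moreover have "convex (epigraph (cbox l u) h)"
    unfolding cut using poly
    by (intro convex_Int convex_Times polyhedron_imp_convex) (auto simp: polyhedral_convex_fun_def)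
  ultimately have "g x - h x \<le> \<epsilon>" if "x \<in> cbox l u" for x
    using gap_le_if_gap_le_on_vert[OF assms(2) compact_cbox _ _
        algorithm1_state_subdifferential_nonempty[OF state] that gap]
    by blast
  then show ?thesis
    using poly algorithm1_state_le[OF state assms(4)]
    by (simp add: eps_polyhedral_underestimator_def)
qed

end
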